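(* Let $n\ge0$ be an integer and $\sigma\ge n+1$ a real number. For every $f\in S_n^\sigma$ there exists $p\in P$ such that $$f(z)=l_n^\sigma\left\{z\cdot\exp\left(\int_0^z\frac{p(t)-1}{t}\,dt\right)\right\},\qquad z\in E.$$
   Context: Let $E=\{z\in\mathbb{C}:|z|<1\}$ and let $A$ be the class of analytic functions on $E$ of the form $f(z)=z+\sum_{k\ge2}a_kz^k$. Let $P$ be the class of analytic functions $p(z)=1+c_1z+c_2z^2+\cdots$ on $E$ with $\mathrm{Re}\,p(z)>0$ for $z\in E$. For an integer $n\ge0$ and a real number $\sigma$ with $\sigma-(n-1)>0$, the operator $L_n^\sigma:A\to A$ is defined by $$L_n^\sigma f(z)=z+\sum_{k=2}^\infty\left\{\prod_{j=0}^{n-1}\frac{\sigma+k-1-j}{\sigma-j}\right\}a_kz^k$$ (the empty product is $1$), and $l_n^\sigma:A\to A$ is its inverse, $$l_n^\sigma f(z)=z+\sum_{k=2}^\infty\left\{\prod_{j=0}^{n-1}\frac{\sigma-j}{\sigma+k-1-j}\right\}a_kz^k,$$ so that $L_n^\sigma(l_n^\sigma f)=l_n^\sigma(L_n^\sigma f)=f$. For an integer $n\ge0$ and real $\sigma\ge n+1$, a function $f\in A$ belongs to the class $S_n^\sigma$ if and only if $$\mathrm{Re}\,\frac{L_{n+1}^\sigma f(z)}{L_n^\sigma f(z)}>\frac{\sigma-(n+1)}{\sigma-n},\qquad z\in E,$$ where the quotient at $z=0$ is understood as its limit $1$. *)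

theory Defs
  imports "HOL-Complex_Analysis.Complex_Analysis"
begin

abbreviation E :: "complex set" where
  "E \<equiv> ball 0 1"

text \<open>Functions are total on the complex plane; only their values on the open unit disc matter,
  and membership in the classes below constrains nothing else.\<close>

definition class_A :: "(complex \<Rightarrow> complex) set" where
  "class_A = {f. f holomorphic_on E \<and>
     (\<exists>a. \<forall>z\<in>E. (\<lambda>k. a (k + 2) * z ^ (k + 2)) sums (f z - z))}"

definition class_P :: "(complex \<Rightarrow> complex) set" where
  "class_P = {p. p holomorphic_on E \<and>
     (\<exists>c. \<forall>z\<in>E. (\<lambda>k. c (k + 1) * z ^ (k + 1)) sums (p z - 1)) \<and>
     (\<forall>z\<in>E. Re (p z) > 0)}"

definition taylor_coeff :: "(complex \<Rightarrow> complex) \<Rightarrow> nat \<Rightarrow> complex" where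
  "taylor_coeff f k = (deriv ^^ k) f 0 / fact k"

definition L_op :: "nat \<Rightarrow> real \<Rightarrow> (complex \<Rightarrow> complex) \<Rightarrow> complex \<Rightarrow> complex" where
  "L_op n \<sigma> f z = z + (\<Sum>i. let k = i + 2 in
     of_real (\<Prod>j<n. (\<sigma> + real k - 1 - real j) / (\<sigma> - real j)) * taylor_coeff f k * z ^ k)"

definition l_op :: "nat \<Rightarrow> real \<Rightarrow> (complex \<Rightarrow> complex) \<Rightarrow> complex \<Rightarrow> complex" where
  "l_op n \<sigma> f z = z + (\<Sum>i. let k = i + 2 in
     of_real (\<Prod>j<n. (\<sigma> - real j) / (\<sigma> + real k - 1 - real j)) * taylor_coeff f k * z ^ k)"

text \<open>At the origin the quotient takes its limit value 1.  For \<open>\<sigma> \<ge> n + 1\<close> the bound is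
  nonnegative, so at any other zero of the denominator the convention \<open>x / 0 = 0\<close> makes the
  inequality fail: members of the class automatically have \<open>L_op n \<sigma> f z \<noteq> 0\<close> for
  \<open>z \<noteq> 0\<close>, as the condition on the quotient presupposes.\<close>

definition class_S :: "nat \<Rightarrow> real \<Rightarrow> (complex \<Rightarrow> complex) set" where
  "class_S n \<sigma> = {f \<in> class_A. \<forall>z\<in>E.
     Re (if z = 0 then 1 else L_op (n + 1) \<sigma> f z / L_op n \<sigma> f z)
       > (\<sigma> - (real n + 1)) / (\<sigma> - real n)}"

end

theory Submission
  imports Defs
begin

text \<open>
  Put \<open>g = L\<^sub>n f\<close>.  Passing from \<open>n\<close> to \<open>n + 1\<close> multiplies the \<open>k\<close>-th coefficient by
  \<open>(\<sigma> + k - 1 - n) / (\<sigma> - n)\<close>, a factor that is affine in \<open>k\<close>.  Since multiplying the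
  \<open>k\<close>-th coefficient by \<open>k\<close> is the action of \<open>z d/dz\<close>, this gives
  \<open>(\<sigma> - n) L\<^bsub>n+1\<^esub> f = (\<sigma> - n - 1) g + z g'\<close> (lemma \<open>eval_L_fps_Suc\<close>).
  After division by \<open>g\<close>, the bound that defines the class \<open>S\<close> says exactly that
  \<open>Re (z g' / g) > 0\<close> on the disc; in other words, \<open>g\<close> is starlike.

  The function \<open>p = z g' / g\<close> is therefore the required member of \<open>P\<close>.  Writing
  \<open>g = z h\<close>, the function \<open>h\<close> has no zeros, \<open>h 0 = 1\<close>, and \<open>(p - 1) / z = h' / h\<close>, so
  integrating the logarithmic derivative of \<open>h\<close> recovers \<open>h\<close>
  (lemma \<open>starlike_exp_representation\<close>).  Finally \<open>f\<close> is recovered from \<open>g\<close>, because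
  \<open>l\<^sub>n\<close> inverts the multipliers of \<open>L\<^sub>n\<close> (lemma \<open>l_op_inverts_L_fps\<close>).

  The operators read Taylor coefficients at the origin and reassemble them.  Representing
  them on formal power series makes the coefficient algebra purely formal, and the recursion
  in \<open>n\<close> also shows that no radius of convergence shrinks.
\<close>

section \<open>The operators on formal power series\<close>

definition L_fps :: "nat \<Rightarrow> real \<Rightarrow> complex fps \<Rightarrow> complex fps" where
  "L_fps n \<sigma> F = Abs_fps (\<lambda>k.
     of_real (\<Prod>j<n. (\<sigma> + real k - 1 - real j) / (\<sigma> - real j)) * fps_nth F k)"

lemma L_fps_0 [simp]: "L_fps 0 \<sigma> F = F"
  by (simp add: L_fps_def fps_eq_iff)

text \<open>
  The new factor \<open>(\<sigma> + k - 1 - n) / (\<sigma> - n)\<close> splits as a constant plus a multiple of \<open>k\<close>,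
  and \<open>X d/dX\<close> multiplies the \<open>k\<close>-th coefficient by \<open>k\<close>.  The identity is formal: with the
  convention \<open>1 / 0 = 0\<close> it includes \<open>\<sigma> = n\<close>, where both sides vanish.
\<close>

lemma L_fps_Suc:
  "L_fps (Suc n) \<sigma> F = fps_const (of_real (1 / (\<sigma> - real n))) *
     (fps_const (of_real (\<sigma> - (real n + 1))) * L_fps n \<sigma> F + fps_X * fps_deriv (L_fps n \<sigma> F))"
proof (rule fps_ext)
  fix k
  have [simp]: "fps_nth (fps_X * fps_deriv G) k = of_nat k * fps_nth G k" for G :: "complex fps"
    by (cases k) simp_all
  show "fps_nth (L_fps (Suc n) \<sigma> F) k = fps_nth (fps_const (of_real (1 / (\<sigma> - real n))) *
     (fps_const (of_real (\<sigma> - (real n + 1))) * L_fps n \<sigma> F + fps_X * fps_deriv (L_fps n \<sigma> F))) k"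
    by (simp add: L_fps_def divide_inverse algebra_simps)
qed

lemma L_fps_nth_0: "fps_nth F 0 = 0 \<Longrightarrow> fps_nth (L_fps n \<sigma> F) 0 = 0"
  by (simp add: L_fps_def)

lemma L_fps_nth_1:
  assumes "real n < \<sigma> + 1"
  shows "fps_nth (L_fps n \<sigma> F) 1 = fps_nth F 1"
proof -
  have "(\<Prod>j<n. (\<sigma> + real 1 - 1 - real j) / (\<sigma> - real j)) = 1"
    by (rule prod.neutral) (use assms in auto)
  then show ?thesis by (simp add: L_fps_def del: of_real_prod)
qed

text \<open>
  Neither sums, products with polynomials nor formal differentiation decrease the radius of
  convergence, so the recursion in \<open>n\<close> gives the bound without estimating the multipliers.
\<close>

lemma conv_radius_L_fps: "fps_conv_radius (L_fps n \<sigma> F) \<ge> fps_conv_radius F"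
proof (induction n)
  case (Suc n)
  let ?G = "L_fps n \<sigma> F"
  have *: "fps_conv_radius (fps_const c * A) \<ge> fps_conv_radius A" for c :: complex and A
    using fps_conv_radius_mult[of "fps_const c" A] by simp
  have "fps_conv_radius F \<le> fps_conv_radius ?G" by fact
  also have "\<dots> \<le> min (fps_conv_radius (fps_const (of_real (\<sigma> - (real n + 1))) * ?G))
                        (fps_conv_radius (fps_X * fps_deriv ?G))"
    using * fps_conv_radius_mult[of fps_X "fps_deriv ?G"] fps_conv_radius_deriv[of ?G]
    by (auto intro: order.trans)
  also have "\<dots> \<le> fps_conv_radius (fps_const (of_real (\<sigma> - (real n + 1))) * ?G + fps_X * fps_deriv ?G)"
    by (rule fps_conv_radius_add)
  also have "\<dots> \<le> fps_conv_radius (L_fps (Suc n) \<sigma> F)"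
    unfolding L_fps_Suc by (rule *)
  finally show ?case .
qed auto

lemma eval_L_fps_Suc:
  assumes "norm z < fps_conv_radius F" "\<sigma> \<noteq> real n"
  shows "of_real (\<sigma> - real n) * eval_fps (L_fps (Suc n) \<sigma> F) z =
           of_real (\<sigma> - (real n + 1)) * eval_fps (L_fps n \<sigma> F) z +
           z * deriv (eval_fps (L_fps n \<sigma> F)) z"
proof -
  let ?G = "L_fps n \<sigma> F" and ?a = "of_real (\<sigma> - (real n + 1)) :: complex"
  have G: "norm z < fps_conv_radius ?G"
    using assms(1) conv_radius_L_fps[of F n \<sigma>] by (rule less_le_trans)
  have G': "norm z < fps_conv_radius (fps_deriv ?G)"
    using G fps_conv_radius_deriv by (rule less_le_trans)
  have aG: "norm z < fps_conv_radius (fps_const ?a * ?G)"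
    by (rule less_le_trans[OF _ fps_conv_radius_mult]) (use G in simp)
  have XG': "norm z < fps_conv_radius (fps_X * fps_deriv ?G)"
    by (rule less_le_trans[OF _ fps_conv_radius_mult]) (use G' in simp)
  have sum: "norm z < fps_conv_radius (fps_const ?a * ?G + fps_X * fps_deriv ?G)"
    by (rule less_le_trans[OF _ fps_conv_radius_add]) (use aG XG' in simp)
  have "eval_fps (L_fps (Suc n) \<sigma> F) z =
          of_real (1 / (\<sigma> - real n)) * (?a * eval_fps ?G z + z * deriv (eval_fps ?G) z)"
    unfolding L_fps_Suc using G G' aG XG' sum
    by (simp add: eval_fps_mult eval_fps_add eval_fps_deriv del: of_real_diff of_real_divide)
  moreover have "of_real (\<sigma> - real n) * of_real (1 / (\<sigma> - real n)) = (1 :: complex)"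
    using assms(2) by (simp only: of_real_mult[symmetric]) simp
  ultimately show ?thesis
    by (metis mult.assoc mult_1)
qed

section \<open>The operators on analytic functions\<close>

lemma eval_fps_split_normalized:
  fixes F :: "complex fps"
  assumes "norm z < fps_conv_radius F" "fps_nth F 0 = 0" "fps_nth F 1 = 1"
  shows "eval_fps F z = z + (\<Sum>i. fps_nth F (i + 2) * z ^ (i + 2))"
  using suminf_split_initial_segment[OF summable_fps[OF assms(1)], of 2] assms(2,3)
  by (simp add: eval_fps_def numeral_2_eq_2)

lemma L_op_eq_eval_fps:
  assumes "f has_fps_expansion F" "fps_nth F 0 = 0" "fps_nth F 1 = 1"
    and "real n < \<sigma> + 1" and "norm z < fps_conv_radius F"
  shows "L_op n \<sigma> f z = eval_fps (L_fps n \<sigma> F) z"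
proof -
  have "taylor_coeff f k = fps_nth F k" for k
    using fps_nth_fps_expansion[OF assms(1)] by (simp add: taylor_coeff_def)
  moreover have "eval_fps (L_fps n \<sigma> F) z =
      z + (\<Sum>i. fps_nth (L_fps n \<sigma> F) (i + 2) * z ^ (i + 2))"
    using less_le_trans[OF assms(5) conv_radius_L_fps] L_fps_nth_0[OF assms(2)]
      L_fps_nth_1[OF assms(4)] assms(3)
    by (intro eval_fps_split_normalized) simp_all
  ultimately show ?thesis
    by (simp add: L_fps_def L_op_def Let_def del: of_real_prod)
qed

text \<open>
  Only the germ of \<open>g\<close> at the origin enters \<open>l_op\<close>, which is why an expansion of \<open>g\<close> is
  enough.  The assumption on \<open>\<sigma>\<close> makes all factors \<open>\<sigma> - j\<close> and \<open>\<sigma> + k - 1 - j\<close> positive,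
  so the two multipliers are reciprocal.
\<close>

lemma l_op_inverts_L_fps:
  assumes "g has_fps_expansion L_fps n \<sigma> F" "fps_nth F 0 = 0" "fps_nth F 1 = 1"
    and "real n < \<sigma> + 1" and "norm z < fps_conv_radius F"
  shows "l_op n \<sigma> g z = eval_fps F z"
proof -
  have g: "taylor_coeff g k = fps_nth (L_fps n \<sigma> F) k" for k
    using fps_nth_fps_expansion[OF assms(1)] by (simp add: taylor_coeff_def)
  have "of_real (\<Prod>j<n. (\<sigma> - real j) / (\<sigma> + real k - 1 - real j)) * taylor_coeff g k = fps_nth F k"
    if "k \<ge> 2" for k
  proof -
    have "(\<Prod>j<n. (\<sigma> - real j) / (\<sigma> + real k - 1 - real j)) *
          (\<Prod>j<n. (\<sigma> + real k - 1 - real j) / (\<sigma> - real j)) = 1"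
      unfolding prod.distrib[symmetric] by (rule prod.neutral) (use assms(4) that in auto)
    then have "of_real (\<Prod>j<n. (\<sigma> - real j) / (\<sigma> + real k - 1 - real j)) *
       of_real (\<Prod>j<n. (\<sigma> + real k - 1 - real j) / (\<sigma> - real j)) = (1 :: complex)"
      by (metis of_real_mult of_real_1)
    then show ?thesis
      by (simp add: g L_fps_def flip: mult.assoc del: of_real_prod)
  qed
  then have "of_real (\<Prod>j<n. (\<sigma> - real j) / (\<sigma> + real (i + 2) - 1 - real j)) * taylor_coeff g (i + 2) =
      fps_nth F (i + 2)" for i
    using le_add2 .
  then have "l_op n \<sigma> g z = z + (\<Sum>i. fps_nth F (i + 2) * z ^ (i + 2))"
    unfolding l_op_def Let_def by (simp only:)
  then show ?thesis
    using eval_fps_split_normalized[OF assms(5,2,3)] by simp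
qed

section \<open>Starlike functions\<close>

text \<open>
  On a convex set the nonvanishing function \<open>h\<close> has a holomorphic logarithm, and that
  logarithm is a primitive of \<open>h' / h\<close>.
\<close>

lemma exp_contour_integral_log_deriv:
  assumes "open S" "convex S" "h holomorphic_on S" "\<And>z. z \<in> S \<Longrightarrow> h z \<noteq> 0"
    and "a \<in> S" "w \<in> S"
  shows "exp (contour_integral (linepath a w) (\<lambda>t. deriv h t / h t)) = h w / h a"
proof -
  obtain \<phi> where hol: "\<phi> holomorphic_on S" and exp: "\<And>z. z \<in> S \<Longrightarrow> h z = exp (\<phi> z)"
    using contractible_imp_holomorphic_log[OF assms(3) convex_imp_contractible[OF assms(2)] assms(4)]
    by blast
  have "(\<phi> has_field_derivative deriv h z / h z) (at z within S)" if z: "z \<in> S" for z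
  proof -
    have d\<phi>: "(\<phi> has_field_derivative deriv \<phi> z) (at z)"
      using hol assms(1) z by (rule holomorphic_derivI)
    then have "((\<lambda>z. exp (\<phi> z)) has_field_derivative exp (\<phi> z) * deriv \<phi> z) (at z)"
      by (rule DERIV_chain2[OF DERIV_exp])
    then have "(h has_field_derivative h z * deriv \<phi> z) (at z)"
      using assms(1) z exp by (auto intro: has_field_derivative_transform_within_open)
    then have "deriv h z / h z = deriv \<phi> z"
      using assms(4)[OF z] by (simp add: DERIV_imp_deriv)
    then show ?thesis using d\<phi> by (simp add: has_field_derivative_at_within)
  qed
  then have "((\<lambda>t. deriv h t / h t) has_contour_integral \<phi> w - \<phi> a) (linepath a w)"
    using contour_integral_primitive[of S \<phi> _ "linepath a w"] assms
    by (simp add: closed_segment_subset)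
  then show ?thesis
    using assms(5,6) by (simp add: contour_integral_unique exp exp_diff)
qed

lemma class_PI:
  assumes "p holomorphic_on E" "p 0 = 1" "\<And>z. z \<in> E \<Longrightarrow> Re (p z) > 0"
  shows "p \<in> class_P"
proof -
  have "(\<lambda>k. taylor_coeff p (k + 1) * z ^ (k + 1)) sums (p z - 1)" if "z \<in> E" for z
    using holomorphic_power_series[OF assms(1) that] assms(2) 
      sums_split_initial_segment[of "\<lambda>k. taylor_coeff p k * z ^ k" "p z" 1]
    by (simp add: taylor_coeff_def)
  then have "\<exists>c. \<forall>z\<in>E. (\<lambda>k. c (k + 1) * z ^ (k + 1)) sums (p z - 1)" by blast
  then show ?thesis using assms by (simp add: class_P_def)
qed

text \<open>
  The hypothesis excludes zeros of \<open>g\<close> away from the origin, because division by zero yields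
  zero, and the zero at the origin is simple.  Hence \<open>g(z) / z\<close> extends to a holomorphic
  function \<open>h\<close> without zeros.  Taking \<open>p = 1 + z h' / h\<close> instead of \<open>z g' / g\<close> avoids the
  removable singularity of the latter.
\<close>

lemma starlike_exp_representation:
  assumes hol: "g holomorphic_on E" and g0: "g 0 = 0" "deriv g 0 = 1"
    and star: "\<And>z. z \<in> E \<Longrightarrow> z \<noteq> 0 \<Longrightarrow> Re (z * deriv g z / g z) > 0"
  shows "\<exists>p\<in>class_P. \<forall>z\<in>E. g z = z * exp (contour_integral (linepath 0 z) (\<lambda>t. (p t - 1) / t))"
proof -
  define h where "h z = (if z = 0 then deriv g 0 else (g z - g 0) / (z - 0))" for z
  have holh: "h holomorphic_on E"
    unfolding h_def using pole_lemma[OF hol, of 0] by simp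
  have h0: "h 0 = 1" and gh: "g z = z * h z" for z
    using g0 by (simp_all add: h_def)
  have hnz: "h z \<noteq> 0" if "z \<in> E" for z
    using star[OF that] h0 gh[of z] by (cases "z = 0") auto
  define p where "p z = 1 + z * (deriv h z / h z)" for z
  have dg: "deriv g z = h z + z * deriv h z" if "z \<in> E" for z
  proof -
    have "(h has_field_derivative deriv h z) (at z)"
      using holh open_ball that by (rule holomorphic_derivI)
    then have "((\<lambda>z. z * h z) has_field_derivative h z + z * deriv h z) (at z)"
      by (auto intro!: derivative_eq_intros)
    moreover have "(\<lambda>z. z * h z) = g" using gh by auto
    ultimately show ?thesis by (simp add: DERIV_imp_deriv)
  qed
  have "p \<in> class_P"
  proof (rule class_PI)
    show "p holomorphic_on E"
      unfolding p_def using holh hnz by (intro holomorphic_intros) auto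
    show "p 0 = 1" by (simp add: p_def)
    show "Re (p z) > 0" if z: "z \<in> E" for z
    proof (cases "z = 0")
      case False
      have "p z = z * deriv g z / g z"
        using False hnz[OF z] by (simp add: p_def dg[OF z] gh field_simps)
      then show ?thesis using star[OF z False] by simp
    qed (simp add: p_def)
  qed
  moreover have "g z = z * exp (contour_integral (linepath 0 z) (\<lambda>t. (p t - 1) / t))"
    if z: "z \<in> E" for z
  proof (cases "z = 0")
    case False
    \<comment> \<open>At \<open>t = 0\<close> the left integrand is \<open>0\<close> by convention rather than \<open>h' 0 / h 0\<close>; a single
      point of the path does not affect the integral.\<close>
    have "contour_integral (linepath 0 z) (\<lambda>t. (p t - 1) / t) =
          contour_integral (linepath 0 z) (\<lambda>t. deriv h t / h t)"
      by (rule contour_integral_spike_finite_simple_path[where A = "{0}"]) (use False in \<open>auto simp: p_def\<close>)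
    then show ?thesis
      using exp_contour_integral_log_deriv[of E h 0 z] holh hnz z h0 gh by simp
  qed (use g0 in simp)
  ultimately show ?thesis by blast
qed

section \<open>The exponential formula for the class \<open>S\<close>\<close>

lemma class_A_fps:
  assumes "f \<in> class_A"
  shows "\<exists>F. f has_fps_expansion F \<and> fps_nth F 0 = 0 \<and> fps_nth F 1 = 1 \<and>
    fps_conv_radius F \<ge> 1 \<and> (\<forall>z\<in>E. eval_fps F z = f z)"
proof -
  from assms obtain a where hol: "f holomorphic_on E"
    and a: "\<forall>z\<in>E. (\<lambda>k. a (k + 2) * z ^ (k + 2)) sums (f z - z)"
    unfolding class_A_def by blast
  define F where "F = Abs_fps (\<lambda>k. if k = 0 then 0 else if k = 1 then 1 else a k)"
  have sums: "(\<lambda>k. fps_nth F k * z ^ k) sums f z" if "z \<in> E" for z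
  proof -
    have "(\<lambda>k. fps_nth F (k + 2) * z ^ (k + 2)) sums (f z - (\<Sum>k<2. fps_nth F k * z ^ k))"
      using bspec[OF a that] by (simp add: F_def numeral_2_eq_2)
    then show ?thesis by (subst (asm) sums_iff_shift) simp
  qed
  have F: "f has_fps_expansion F"
    by (rule has_fps_expansionI)
       (use sums eventually_nhds_in_open[of E 0] in \<open>auto elim!: eventually_mono\<close>)
  have "fps_conv_radius F \<ge> 1"
    using holomorphic_on_imp_fps_conv_radius_ge[OF F, of 1] hol by (simp add: one_ereal_def)
  moreover have "\<forall>z\<in>E. eval_fps F z = f z"
    using sums by (simp add: eval_fps_def sums_iff)
  moreover have "fps_nth F 0 = 0" "fps_nth F 1 = 1" by (simp_all add: F_def)
  ultimately show ?thesis using F by blast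
qed

text \<open>
  This turns the bound defining the class \<open>S\<close> into starlikeness, with
  \<open>c = \<sigma> - n\<close>, \<open>a = \<sigma> - n - 1\<close>, \<open>v = L\<^sub>n f\<close>, \<open>u = L\<^bsub>n+1\<^esub> f\<close> and \<open>w = z v'\<close>.  A vanishing
  denominator \<open>v\<close> would make the quotient \<open>0\<close>, which the nonnegative bound \<open>a / c\<close> rules out.
\<close>

lemma Re_divide_of_real_combination_gt:
  fixes u v w :: complex and a c :: real
  assumes "c > 0" "a \<ge> 0" "of_real c * u = of_real a * v + w" "Re (u / v) > a / c"
  shows "Re (w / v) > 0"
proof -
  have "a / c \<ge> 0" using assms(1,2) by simp
  then have "v \<noteq> 0" using assms(4) by auto
  then have "w / v = of_real c * (u / v) - of_real a"
    using assms(3) by (simp add: field_simps)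
  then have "Re (w / v) = c * Re (u / v) - a" by (simp del: times_divide_eq_right)
  then show ?thesis using assms(1,4) by (simp add: field_simps)
qed

theorem theorem4:
  fixes n :: nat and \<sigma> :: real and f :: "complex \<Rightarrow> complex"
  assumes "\<sigma> \<ge> real n + 1"
    and "f \<in> class_S n \<sigma>"
  shows "\<exists>p\<in>class_P. \<forall>z\<in>E. f z = l_op n \<sigma>
    (\<lambda>w. w * exp (contour_integral (linepath 0 w) (\<lambda>t. (p t - 1) / t))) z"
proof -
  have A: "f \<in> class_A" using assms(2) by (simp add: class_S_def)
  obtain F where F: "f has_fps_expansion F" "fps_nth F 0 = 0" "fps_nth F 1 = 1"
    "fps_conv_radius F \<ge> 1" "\<forall>z\<in>E. eval_fps F z = f z"
    using class_A_fps[OF A] by blast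
  have in_disc: "ereal (norm z) < fps_conv_radius F" if "z \<in> E" for z
    by (rule less_le_trans[OF _ F(4)]) (use that in \<open>simp add: one_ereal_def\<close>)
  define G where "G = L_fps n \<sigma> F"
  have G_radius: "fps_conv_radius G \<ge> 1"
    using F(4) conv_radius_L_fps unfolding G_def by (rule order.trans)
  have G_exp: "eval_fps G has_fps_expansion G"
    by (rule eval_fps_has_fps_expansion[OF less_le_trans[OF _ G_radius]]) simp
  have "fps_nth G 0 = 0" "fps_nth G 1 = 1"
    using L_fps_nth_0[OF F(2)] L_fps_nth_1[of n \<sigma> F] F(3) assms(1) by (simp_all add: G_def)
  moreover have "eval_fps G holomorphic_on E"
    by (rule holomorphic_on_eval_fps) (use ball_eball_mono G_radius in \<open>auto simp: one_ereal_def\<close>)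
  moreover have "Re (z * deriv (eval_fps G) z / eval_fps G z) > 0" if z: "z \<in> E" "z \<noteq> 0" for z
  proof (rule Re_divide_of_real_combination_gt)
    show "of_real (\<sigma> - real n) * eval_fps (L_fps (Suc n) \<sigma> F) z =
      of_real (\<sigma> - (real n + 1)) * eval_fps G z + z * deriv (eval_fps G) z"
      unfolding G_def by (rule eval_L_fps_Suc) (use in_disc[OF z(1)] assms(1) in auto)
    have "L_op (n + 1) \<sigma> f z = eval_fps (L_fps (Suc n) \<sigma> F) z" "L_op n \<sigma> f z = eval_fps G z"
      unfolding G_def using L_op_eq_eval_fps[OF F(1-3) _ in_disc[OF z(1)]] assms(1) by simp_all
    moreover have "Re (L_op (n + 1) \<sigma> f z / L_op n \<sigma> f z) > (\<sigma> - (real n + 1)) / (\<sigma> - real n)"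
      using assms(2) z unfolding class_S_def by force
    ultimately show "Re (eval_fps (L_fps (Suc n) \<sigma> F) z / eval_fps G z) >
        (\<sigma> - (real n + 1)) / (\<sigma> - real n)"
      by simp
  qed (use assms(1) in auto)
  ultimately obtain p where p: "p \<in> class_P" "\<And>z. z \<in> E \<Longrightarrow>
      eval_fps G z = z * exp (contour_integral (linepath 0 z) (\<lambda>t. (p t - 1) / t))"
    using starlike_exp_representation[of "eval_fps G"] fps_nth_fps_expansion[OF G_exp, of 0]
      fps_nth_fps_expansion[OF G_exp, of 1] by auto
  have "(\<lambda>w. w * exp (contour_integral (linepath 0 w) (\<lambda>t. (p t - 1) / t))) has_fps_expansion G"
  proof (subst has_fps_expansion_cong[OF _ refl])
    show "\<forall>\<^sub>F w in nhds 0. w * exp (contour_integral (linepath 0 w) (\<lambda>t. (p t - 1) / t)) = eval_fps G w"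
      using eventually_nhds_in_open[of E 0] p(2) by (auto elim!: eventually_mono)
  qed (rule G_exp)
  then have "f z = l_op n \<sigma> (\<lambda>w. w * exp (contour_integral (linepath 0 w) (\<lambda>t. (p t - 1) / t))) z"
    if "z \<in> E" for z
    using l_op_inverts_L_fps[of _ n \<sigma> F] F in_disc[OF that] that assms(1) by (simp add: G_def)
  with p(1) show ?thesis by blast
qed

end
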